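(* Let $\mathbf{A}_0,\dots,\mathbf{A}_m\in\mathbb{R}^{n\times n}$, $\sigma_u,\sigma_w>0$, and consider the bilinear system $$\mathbf{x}_{t+1} = \mathbf{A}_0\mathbf{x}_t + \sum_{k=1}^m \mathbf{u}_t[k]\,\mathbf{A}_k\mathbf{x}_t + \mathbf{w}_{t+1},\qquad t\ge 0,$$ where $\{\mathbf{u}_t\}_{t\ge 0}$ are i.i.d. $\mathcal{N}(0,\sigma_u^2\mathbf{I}_m)$ and $\{\mathbf{w}_t\}_{t\ge 1}$ are i.i.d. $\mathcal{N}(0,\sigma_w^2\mathbf{I}_n)$, with the input sequence, the noise sequence and $\mathbf{x}_0$ mutually independent. For $t\ge 1$ let $$\tilde{\mathbf{x}}_t := \begin{bmatrix}\mathbf{x}_t^\top & \sigma_u^{-1}\mathbf{u}_t[1]\mathbf{x}_t^\top & \cdots & \sigma_u^{-1}\mathbf{u}_t[m]\mathbf{x}_t^\top\end{bmatrix}^\top\in\mathbb{R}^{n(m+1)}.$$ Then, with respect to the filtration $\{\mathcal{F}_t\}_{t\ge 0}$ given by $\mathcal{F}_0 := \sigma(\mathbf{x}_0,\mathbf{u}_0)$ and $\mathcal{F}_t := \sigma(\mathbf{x}_0,\dots,\mathbf{x}_t,\mathbf{u}_0,\dots,\mathbf{u}_t,\mathbf{w}_1,\dots,\mathbf{w}_t)$ for $t\ge 1$, the process $\{\tilde{\mathbf{x}}_t\}_{t\ge 1}$ satisfies the $(k, c^2\sigma_w^2\mathbf{I}_{n(m+1)}, p)$-block martingale small-ball condition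 with $k=1$, $c=1/2$ and $p=9/320$.
   Context: $n,m\ge 1$ are integers; $\mathbf{x}_t\in\mathbb{R}^n$, $\mathbf{u}_t\in\mathbb{R}^m$, $\mathbf{w}_t\in\mathbb{R}^n$, and $\mathbf{u}_t[k]$ is the $k$-th entry of $\mathbf{u}_t$. $\mathcal{S}^{d-1}$ denotes the unit sphere in $\mathbb{R}^d$. Block martingale small-ball (BMSB) condition: a real-valued process $\{Z_t\}_{t\ge 1}$ adapted to a filtration $\{\mathcal{F}_t\}$ satisfies the $(k,\nu,p)$-BMSB condition if for every integer $j\ge 0$ one has $\frac{1}{k}\sum_{i=1}^k \mathbb{P}\big(|Z_{j+i}|\ge\nu \mid \mathcal{F}_j\big)\ge p$ almost surely. An adapted process $\{\mathbf{z}_t\}_{t\ge 1}$ with values in $\mathbb{R}^d$ satisfies the $(k,\boldsymbol{\Gamma}_{\rm sb},p)$-BMSB condition, for a positive definite matrix $\boldsymbol{\Gamma}_{\rm sb}\succ 0$, if for every fixed $\mathbf{v}\in\mathcal{S}^{d-1}$ the real process $Z_t=\langle\mathbf{v},\mathbf{z}_t\rangle$ satisfies the $(k,\sqrt{\mathbf{v}^\top\boldsymbol{\Gamma}_{\rm sb}\mathbf{v}},p)$-BMSB condition. *)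

theory Defs
  imports "HOL-Probability.Probability"
begin

definition pos_def :: "real^'d^'d \<Rightarrow> bool" where
  "pos_def \<Gamma> \<longleftrightarrow> transpose \<Gamma> = \<Gamma> \<and> (\<forall>v. v \<noteq> 0 \<longrightarrow> v \<bullet> (\<Gamma> *v v) > 0)"

definition gaussian_density :: "real^'d \<Rightarrow> real^'d^'d \<Rightarrow> real^'d \<Rightarrow> real" where
  "gaussian_density \<mu> \<Sigma> y =
     exp (- ((y - \<mu>) \<bullet> (matrix_inv \<Sigma> *v (y - \<mu>))) / 2) / sqrt ((2 * pi) ^ CARD('d) * det \<Sigma>)"

text \<open>Non-degenerate Gaussian vectors only: meaningful for positive definite \<open>\<Sigma>\<close>.\<close>

definition gaussian :: "'a measure \<Rightarrow> ('a \<Rightarrow> real^'d) \<Rightarrow> real^'d \<Rightarrow> real^'d^'d \<Rightarrow> bool" where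
  "gaussian M X \<mu> \<Sigma> \<longleftrightarrow> distributed M lborel X (\<lambda>y. ennreal (gaussian_density \<mu> \<Sigma> y))"

definition gen_events :: "'a measure \<Rightarrow> 'i set \<Rightarrow> ('i \<Rightarrow> 'a \<Rightarrow> 'b::topological_space) \<Rightarrow> 'a set set" where
  "gen_events M I X = sigma_sets (space M) (\<Union>i\<in>I. sets (vimage_algebra (space M) (X i) borel))"

definition cond_probability :: "'a measure \<Rightarrow> 'a measure \<Rightarrow> 'a set \<Rightarrow> 'a \<Rightarrow> real" where
  "cond_probability M F E = real_cond_exp M F (indicator E)"

definition is_filtration :: "'a measure \<Rightarrow> (nat \<Rightarrow> 'a measure) \<Rightarrow> bool" where
  "is_filtration M F \<longleftrightarrow> (\<forall>t. subalgebra M (F t)) \<and> filtration (space M) F"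

text \<open>Processes are indexed by \<open>t \<ge> 1\<close> (the value at \<open>t = 0\<close> is ignored), filtrations by
  \<open>t \<ge> 0\<close>.\<close>

definition bmsb ::
  "'a measure \<Rightarrow> (nat \<Rightarrow> 'a measure) \<Rightarrow> (nat \<Rightarrow> 'a \<Rightarrow> real) \<Rightarrow> nat \<Rightarrow> real \<Rightarrow> real \<Rightarrow> bool" where
  "bmsb M F Z k \<nu> p \<longleftrightarrow>
     is_filtration M F \<and> (\<forall>t\<ge>1. Z t \<in> borel_measurable (F t)) \<and> k \<ge> 1 \<and>
     (\<forall>j. AE \<omega> in M.
        (1 / real k) * (\<Sum>i=1..k. cond_probability M (F j) {\<omega>' \<in> space M. \<bar>Z (j + i) \<omega>'\<bar> \<ge> \<nu>} \<omega>) \<ge> p)"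

definition vec_bmsb ::
  "'a measure \<Rightarrow> (nat \<Rightarrow> 'a measure) \<Rightarrow> (nat \<Rightarrow> 'a \<Rightarrow> real^'d) \<Rightarrow> nat \<Rightarrow> real^'d^'d \<Rightarrow> real \<Rightarrow> bool" where
  "vec_bmsb M F z k \<Gamma> p \<longleftrightarrow>
     is_filtration M F \<and> (\<forall>t\<ge>1. z t \<in> borel_measurable (F t)) \<and> pos_def \<Gamma> \<and>
     (\<forall>v \<in> sphere 0 1. bmsb M F (\<lambda>t \<omega>. v \<bullet> z t \<omega>) k (sqrt (v \<bullet> (\<Gamma> *v v))) p)"

text \<open>The stacked vector in \<open>\<real>\<^sup>n\<^sup>(\<^sup>m\<^sup>+\<^sup>1\<^sup>)\<close> is indexed by block and position within the block:
  block \<open>None\<close> is \<open>x\<close> itself and block \<open>Some k\<close> is \<open>u[k] x / \<sigma>\<close>.\<close>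

definition lift_state :: "real \<Rightarrow> real^'n \<Rightarrow> real^'m \<Rightarrow> real^('m option \<times> 'n)" where
  "lift_state \<sigma> x u =
     (\<chi> i. case i of (None, j) \<Rightarrow> x $ j | (Some k, j) \<Rightarrow> inverse \<sigma> * (u $ k) * (x $ j))"

text \<open>For \<open>t = 0\<close> the index range \<open>{1..t}\<close> of the noise is empty, so this is
  \<open>\<sigma>(x\<^sub>0, u\<^sub>0)\<close>.\<close>

definition nat_filtration ::
  "'a measure \<Rightarrow> (nat \<Rightarrow> 'a \<Rightarrow> real^'n) \<Rightarrow> (nat \<Rightarrow> 'a \<Rightarrow> real^'m) \<Rightarrow> (nat \<Rightarrow> 'a \<Rightarrow> real^'n) \<Rightarrow> nat \<Rightarrow> 'a measure" where
  "nat_filtration M x u w t = sigma (space M)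
     (gen_events M {0..t} x \<union> gen_events M {0..t} u \<union> gen_events M {1..t} w)"

end

(*
  Put c = sigma_w / 2.  Given F_t, the projection of the lifted state at time t + 1 on a unit
  vector v is a(u) . (mu + w), where mu = x_{t+1} - w_{t+1} is F_t-measurable, u = u_{t+1} and
  w = w_{t+1} are independent of F_t and of each other, and a(u) is affine in u with
  E |a(u)|^2 = |v|^2 = 1 and E |a(u)|^4 <= 3.  Given u, the scalar a(u) . w is centred Gaussian, so
  removing mu costs at most a factor 2 in P(|a(u) . (mu + w)| >= c).  Finally Y = a(u) . w has
  E Y^2 = sigma_w^2 and E Y^4 <= 9 sigma_w^4, and a Paley-Zygmund argument yields
  P(|Y| >= c) >= (3/4)^2 / 9 = 1/16.  This proves the bound 1/32 = 10/320 >= 9/320.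
*)

theory Submission
  imports Defs
begin

subsection \<open>Isotropic Gaussian vectors\<close>

text \<open>The obstacle is that a(u) may be arbitrarily small, so no positive bound holds uniformly
  in u, whereas the shift by mu has to be removed for fixed u, where a(u) . w is Gaussian. The usual
  quotient form of Paley-Zygmund does not average well over u. It is therefore replaced by an
  inequality that is linear in the second and fourth moments of Y: for fixed u it yields a bound
  affine in |a(u)|^2 and |a(u)|^4, possibly negative, which can be averaged knowing only the two
  moments of |a(u)|. With the best slope nothing is lost: at the averaged moments the linear form
  also gives 1/16. The 9 in E Y^4 is 3 * 3, one factor from the noise given u and one from |a(u)|^4.

  The other difficulty is that F_t also contains x_1, ..., x_t, while independence is assumed only
  for x_0, the inputs and the noise. The recursion is used to express F_t through these sources.
  Conditioning itself is done by testing on events B of F_t, so that a Fubini argument replaces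
  regular conditional distributions.\<close>

lemma matrix_inv_scaled_identity:
  fixes s :: real
  assumes "s \<noteq> 0"
  shows "matrix_inv (s *\<^sub>R mat 1 :: real^'d^'d) = inverse s *\<^sub>R mat 1"
proof -
  let ?A = "s *\<^sub>R mat 1 :: real^'d^'d" and ?B = "inverse s *\<^sub>R mat 1 :: real^'d^'d"
  have AB: "?A ** ?B = mat 1" "?B ** ?A = mat 1"
    using assms
    by (simp_all add: vec_eq_iff matrix_matrix_mult_def mat_def if_distrib[of "\<lambda>x. _ * x"]
        if_distrib[of "\<lambda>x. x * _"] cong: if_cong)
  have "?A ** matrix_inv ?A = mat 1 \<and> matrix_inv ?A ** ?A = mat 1"
    unfolding matrix_inv_def by (rule someI[of _ ?B]) (use AB in auto)
  then show ?thesis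
    using AB by (metis matrix_mul_assoc matrix_mul_lid matrix_mul_rid)
qed

lemma det_scaled_identity: "det (s *\<^sub>R mat 1 :: real^'d^'d) = s ^ CARD('d)"
  by (subst det_diagonal) (simp_all add: mat_def)

text \<open>The quadratic form is a multiple of the identity, so the exponential splits over the
  coordinates. This product form is the source of both the normality and the independence of the
  coordinates.\<close>

lemma gaussian_density_scaled_identity:
  fixes y :: "real^'d"
  assumes "\<sigma> > 0"
  shows "gaussian_density 0 (\<sigma>\<^sup>2 *\<^sub>R mat 1) y = (\<Prod>i\<in>UNIV. normal_density 0 \<sigma> (y $ i))"
proof -
  have "(\<Prod>i\<in>UNIV. normal_density 0 \<sigma> (y $ i))
      = exp (\<Sum>i\<in>UNIV. - (y $ i)\<^sup>2 / (2 * \<sigma>\<^sup>2)) / sqrt (2 * pi * \<sigma>\<^sup>2) ^ CARD('d)"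
    by (simp add: normal_density_def prod_dividef exp_sum power_one_over)
  also have "(\<Sum>i\<in>UNIV. - (y $ i)\<^sup>2 / (2 * \<sigma>\<^sup>2)) = - (y \<bullet> y) / (2 * \<sigma>\<^sup>2)"
    by (simp add: inner_vec_def power2_eq_square sum_divide_distrib sum_negf)
  also have "sqrt (2 * pi * \<sigma>\<^sup>2) ^ CARD('d) = sqrt ((2 * pi) ^ CARD('d) * (\<sigma>\<^sup>2) ^ CARD('d))"
    by (metis power_mult_distrib real_sqrt_power)
  finally show ?thesis
    using assms
    by (simp add: gaussian_density_def matrix_inv_scaled_identity det_scaled_identity
        scaleR_matrix_vector_assoc[symmetric] field_simps)
qed

lemma Basis_vec_real: "(Basis :: (real^'d) set) = range (\<lambda>i. axis i 1)"
  by (auto simp: Basis_vec_def)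

lemma nn_integral_lborel_vec_prod:
  fixes f :: "'d::finite \<Rightarrow> real \<Rightarrow> ennreal"
  assumes "\<And>i. f i \<in> borel_measurable borel"
  shows "(\<integral>\<^sup>+x. (\<Prod>i\<in>UNIV. f i (x $ i)) \<partial>(lborel :: (real^'d) measure))
       = (\<Prod>i\<in>UNIV. \<integral>\<^sup>+t. f i t \<partial>lborel)"
proof -
  have inj: "inj (\<lambda>i::'d. axis i (1::real))"
    by (simp add: inj_on_def axis_eq_axis)
  \<comment> \<open>\<open>nn_integral_lborel_prod\<close> indexes its factors by basis vectors;
    \<open>g\<close> recovers the coordinate from the vector.\<close>
  define g where "g b = f (THE i. b = axis i 1)" for b :: "real^'d"
  have g: "g (axis i 1) = f i" for i
    by (simp add: g_def axis_eq_axis)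
  have meas: "g b \<in> borel_measurable borel" if "b \<in> Basis" for b
    using that assms by (auto simp: Basis_vec_real g)
  have reindex: "(\<Prod>b\<in>Basis. h b) = (\<Prod>i\<in>UNIV. h (axis i 1))" for h :: "real^'d \<Rightarrow> ennreal"
    unfolding Basis_vec_real using inj by (simp add: prod.reindex)
  show ?thesis
    using nn_integral_lborel_prod[of g, unfolded reindex] meas
    by (simp add: g inner_axis)
qed

lemma measurable_vec_nth [measurable]: "(\<lambda>x::real^'d. x $ i) \<in> borel_measurable borel"
  by (intro borel_measurable_continuous_onI continuous_intros)

context prob_space
begin

lemma gaussian_emeasure_box:
  fixes X :: "'a \<Rightarrow> real^'d"
  assumes X: "gaussian M X 0 (\<sigma>\<^sup>2 *\<^sub>R mat 1)" and "\<sigma> > 0"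
    and A: "\<And>i. A i \<in> sets borel"
  shows "emeasure M (\<Inter>i. (\<lambda>\<omega>. X \<omega> $ i) -` A i \<inter> space M)
       = (\<Prod>i\<in>UNIV. \<integral>\<^sup>+t. ennreal (normal_density 0 \<sigma> t) * indicator (A i) t \<partial>lborel)"
proof -
  have [measurable]: "A i \<in> sets borel" for i by (rule A)
  have S: "{y. \<forall>i. y $ i \<in> A i} \<in> sets (lborel :: (real^'d) measure)"
    by measurable
  have "emeasure M (\<Inter>i. (\<lambda>\<omega>. X \<omega> $ i) -` A i \<inter> space M)
      = emeasure M (X -` {y. \<forall>i. y $ i \<in> A i} \<inter> space M)"
    by (rule arg_cong[where f="emeasure M"]) auto
  also have "\<dots> = (\<integral>\<^sup>+y. ennreal (gaussian_density 0 (\<sigma>\<^sup>2 *\<^sub>R mat 1) y)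
      * indicator {y. \<forall>i. y $ i \<in> A i} y \<partial>lborel)"
    using X S unfolding gaussian_def by (rule distributed_emeasure)
  also have "\<dots> = (\<integral>\<^sup>+y. (\<Prod>i\<in>UNIV. ennreal (normal_density 0 \<sigma> (y $ i)) * indicator (A i) (y $ i))
      \<partial>(lborel :: (real^'d) measure))"
  proof (rule nn_integral_cong)
    fix y :: "real^'d"
    have "indicator {y. \<forall>i. y $ i \<in> A i} y = (\<Prod>i\<in>UNIV. indicator (A i) (y $ i) :: ennreal)"
      by (auto simp: indicator_def)
    then show "ennreal (gaussian_density 0 (\<sigma>\<^sup>2 *\<^sub>R mat 1) y) * indicator {y. \<forall>i. y $ i \<in> A i} y
        = (\<Prod>i\<in>UNIV. ennreal (normal_density 0 \<sigma> (y $ i)) * indicator (A i) (y $ i))"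
      using \<open>\<sigma> > 0\<close> by (simp add: gaussian_density_scaled_identity prod.distrib prod_ennreal)
  qed
  also have "\<dots> = (\<Prod>i\<in>UNIV. \<integral>\<^sup>+t. ennreal (normal_density 0 \<sigma> t) * indicator (A i) t \<partial>lborel)"
    by (rule nn_integral_lborel_vec_prod) measurable
  finally show ?thesis .
qed

lemma gaussian_measurable:
  "gaussian M X \<mu> \<Sigma> \<Longrightarrow> X \<in> borel_measurable M"
  unfolding gaussian_def by (auto dest: distributed_measurable)

lemma gaussian_component_normal:
  fixes X :: "'a \<Rightarrow> real^'d"
  assumes X: "gaussian M X 0 (\<sigma>\<^sup>2 *\<^sub>R mat 1)" and "\<sigma> > 0"
  shows "distributed M lborel (\<lambda>\<omega>. X \<omega> $ i) (normal_density 0 \<sigma>)"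
proof -
  have [measurable]: "X \<in> borel_measurable M" using X by (rule gaussian_measurable)
  have one: "(\<integral>\<^sup>+t. ennreal (normal_density 0 \<sigma> t) \<partial>lborel) = 1"
    using \<open>\<sigma> > 0\<close> by (simp add: nn_integral_eq_integral)
  have "distr M lborel (\<lambda>\<omega>. X \<omega> $ i) = density lborel (normal_density 0 \<sigma>)"
  proof (rule measure_eqI)
    fix B assume "B \<in> sets (distr M lborel (\<lambda>\<omega>. X \<omega> $ i))"
    then have [measurable]: "B \<in> sets borel" by simp
    \<comment> \<open>A marginal is a box that is unrestricted in all other coordinates, where the
      normal density integrates to 1.\<close>
    let ?A = "\<lambda>j. if j = i then B else UNIV"
    have "emeasure (distr M lborel (\<lambda>\<omega>. X \<omega> $ i)) B
        = emeasure M (\<Inter>j. (\<lambda>\<omega>. X \<omega> $ j) -` ?A j \<inter> space M)"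
      by (subst emeasure_distr) (auto intro!: arg_cong[where f="emeasure M"] split: if_splits)
    also have "\<dots> = (\<Prod>j\<in>UNIV. \<integral>\<^sup>+t. ennreal (normal_density 0 \<sigma> t) * indicator (?A j) t \<partial>lborel)"
      using X \<open>\<sigma> > 0\<close> by (rule gaussian_emeasure_box) simp
    also have "\<dots> = (\<Prod>j\<in>UNIV. if j = i then
        \<integral>\<^sup>+t. ennreal (normal_density 0 \<sigma> t) * indicator B t \<partial>lborel else 1)"
      by (intro prod.cong) (auto simp: one)
    also have "\<dots> = emeasure (density lborel (normal_density 0 \<sigma>)) B"
      by (simp add: emeasure_density)
    finally show "emeasure (distr M lborel (\<lambda>\<omega>. X \<omega> $ i)) B
        = emeasure (density lborel (normal_density 0 \<sigma>)) B" .
  qed simp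
  then show ?thesis unfolding distributed_def by simp
qed

lemma gaussian_components_indep:
  fixes X :: "'a \<Rightarrow> real^'d"
  assumes X: "gaussian M X 0 (\<sigma>\<^sup>2 *\<^sub>R mat 1)" and "\<sigma> > 0"
  shows "indep_vars (\<lambda>_. borel) (\<lambda>i \<omega>. X \<omega> $ i) (UNIV :: 'd set)"
proof -
  have [measurable]: "X \<in> borel_measurable M" using X by (rule gaussian_measurable)
  have "emeasure M (\<Inter>i. (\<lambda>\<omega>. X \<omega> $ i) -` A i \<inter> space M)
      = (\<Prod>i\<in>UNIV. emeasure M ((\<lambda>\<omega>. X \<omega> $ i) -` A i \<inter> space M))"
    if A: "\<And>i. A i \<in> sets borel" for A
  proof -
    have "emeasure M ((\<lambda>\<omega>. X \<omega> $ i) -` A i \<inter> space M)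
        = (\<integral>\<^sup>+t. ennreal (normal_density 0 \<sigma> t) * indicator (A i) t \<partial>lborel)" for i
      using distributed_emeasure[OF gaussian_component_normal[OF X \<open>\<sigma> > 0\<close>], of "A i" i] A
      by simp
    then show ?thesis
      using gaussian_emeasure_box[OF X \<open>\<sigma> > 0\<close> A] by simp
  qed
  then have "prob (\<Inter>i. (\<lambda>\<omega>. X \<omega> $ i) -` A i \<inter> space M)
      = (\<Prod>i\<in>UNIV. prob ((\<lambda>\<omega>. X \<omega> $ i) -` A i \<inter> space M))"
    if "\<And>i. A i \<in> sets borel" for A
    using that by (simp add: emeasure_eq_measure prod_ennreal prod_nonneg measure_nonneg)
  then show ?thesis
    by (subst indep_vars_finite[where E="\<lambda>_. sets borel"])
      (auto simp: sets.sigma_sets_eq[of borel, simplified] Int_stable_def)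
qed

lemma gaussian_inner_normal:
  fixes X :: "'a \<Rightarrow> real^'d"
  assumes X: "gaussian M X 0 (\<sigma>\<^sup>2 *\<^sub>R mat 1)" and "\<sigma> > 0" and "c \<noteq> 0"
  shows "distributed M lborel (\<lambda>\<omega>. c \<bullet> X \<omega>) (normal_density 0 (\<sigma> * norm c))"
proof -
  \<comment> \<open>\<open>sum_indep_normal\<close> asks for strictly positive standard deviations,
    so coordinates with coefficient zero are dropped first; \<open>c \<noteq> 0\<close> keeps the
    index set nonempty.\<close>
  let ?I = "{i. c $ i \<noteq> 0}"
  have ne: "?I \<noteq> {}" using \<open>c \<noteq> 0\<close> by (auto simp: vec_eq_iff)
  have "distributed M lborel (\<lambda>\<omega>. \<Sum>i\<in>?I. c $ i * X \<omega> $ i)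
      (normal_density (\<Sum>i\<in>?I. 0) (sqrt (\<Sum>i\<in>?I. (\<bar>c $ i\<bar> * \<sigma>)\<^sup>2)))"
  proof (rule sum_indep_normal[OF _ ne])
    show "indep_vars (\<lambda>i. borel) (\<lambda>i \<omega>. c $ i * X \<omega> $ i) ?I"
      by (rule indep_vars_compose2[OF indep_vars_subset[OF gaussian_components_indep[OF X \<open>\<sigma> > 0\<close>]],
            where Y="\<lambda>i t. c $ i * t"]) auto
    show "distributed M lborel (\<lambda>\<omega>. c $ i * X \<omega> $ i) (normal_density 0 (\<bar>c $ i\<bar> * \<sigma>))" if "i \<in> ?I" for i
      using normal_density_affine[OF gaussian_component_normal[OF X \<open>\<sigma> > 0\<close>, of i] \<open>\<sigma> > 0\<close>, of "c $ i" 0] that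
      by simp
  qed (use \<open>\<sigma> > 0\<close> in auto)
  moreover have "(\<Sum>i\<in>?I. c $ i * X \<omega> $ i) = c \<bullet> X \<omega>" for \<omega>
    unfolding inner_vec_def by (rule sum.mono_neutral_cong_left) auto
  moreover have "sqrt (\<Sum>i\<in>?I. (\<bar>c $ i\<bar> * \<sigma>)\<^sup>2) = \<sigma> * norm c"
  proof -
    have "(\<Sum>i\<in>?I. (\<bar>c $ i\<bar> * \<sigma>)\<^sup>2) = (\<Sum>i\<in>UNIV. (\<bar>c $ i\<bar> * \<sigma>)\<^sup>2)"
      by (rule sum.mono_neutral_left) auto
    also have "\<dots> = (\<sigma> * norm c)\<^sup>2"
      by (simp add: power_mult_distrib sum_distrib_left norm_vec_def L2_set_def sum_nonneg mult.commute)
    finally show ?thesis using \<open>\<sigma> > 0\<close> by simp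
  qed
  ultimately show ?thesis by simp
qed

section \<open>Scalar normal variables: moments, shifts and a small-ball bound\<close>

lemma normal_moments:
  assumes Y: "distributed M lborel Y (normal_density 0 s)" and "s > 0"
  shows "integrable M (\<lambda>\<omega>. Y \<omega> ^ k)"
    and "expectation Y = 0" and "expectation (\<lambda>\<omega>. (Y \<omega>)\<^sup>2) = s\<^sup>2"
    and "expectation (\<lambda>\<omega>. Y \<omega> ^ 3) = 0" and "expectation (\<lambda>\<omega>. Y \<omega> ^ 4) = 3 * s ^ 4"
proof -
  show "integrable M (\<lambda>\<omega>. Y \<omega> ^ k)"
    using distributed_integrable[OF Y, of "\<lambda>t. t ^ k"] integrable_normal_moment[OF \<open>s > 0\<close>, of 0 k]
    by simp
  have E: "expectation (\<lambda>\<omega>. Y \<omega> ^ k) = (\<integral>t. normal_density 0 s t * (t - 0) ^ k \<partial>lborel)" for k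
    using distributed_integral[OF Y, of "\<lambda>t. t ^ k"] by simp
  show "expectation Y = 0"
    using E[of 1] integral_normal_moment_odd[OF \<open>s > 0\<close>, of 0 0] by simp
  show "expectation (\<lambda>\<omega>. Y \<omega> ^ 3) = 0"
    using E[of 3] integral_normal_moment_odd[OF \<open>s > 0\<close>, of 0 1] by (simp add: eval_nat_numeral)
  show "expectation (\<lambda>\<omega>. (Y \<omega>)\<^sup>2) = s\<^sup>2"
    using E[of 2] integral_normal_moment_even[OF \<open>s > 0\<close>, of 0 1] by simp
  show "expectation (\<lambda>\<omega>. Y \<omega> ^ 4) = 3 * s ^ 4"
    using E[of 4] integral_normal_moment_even[OF \<open>s > 0\<close>, of 0 2]
    by (simp add: fact_numeral power_divide)
qed

text \<open>Since \<open>2 * Y = (b + Y) - (b - Y)\<close>, one of \<open>b + Y\<close> and \<open>b - Y\<close> is at least as large as \<open>Y\<close>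
  in absolute value, and both have the same law up to sign.\<close>

lemma normal_shift_prob_ge:
  assumes Y: "distributed M lborel Y (normal_density 0 s)" and "s > 0"
  shows "prob {\<omega> \<in> space M. \<bar>Y \<omega>\<bar> \<ge> c} \<le> 2 * prob {\<omega> \<in> space M. \<bar>b + Y \<omega>\<bar> \<ge> c}"
proof -
  have [measurable]: "Y \<in> borel_measurable M"
    using distributed_measurable[OF Y] by simp
  have neg: "distributed M lborel (\<lambda>\<omega>. - Y \<omega>) (normal_density 0 s)"
    using normal_density_affine[OF Y \<open>s > 0\<close>, of "-1" 0] by simp
  have S: "{t. \<bar>b + t\<bar> \<ge> c} \<in> sets lborel" by simp
  have "emeasure M ((\<lambda>\<omega>. - Y \<omega>) -` {t. \<bar>b + t\<bar> \<ge> c} \<inter> space M)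
      = emeasure M (Y -` {t. \<bar>b + t\<bar> \<ge> c} \<inter> space M)"
    unfolding distributed_emeasure[OF neg S] distributed_emeasure[OF Y S] ..
  then have sym: "prob {\<omega> \<in> space M. \<bar>b - Y \<omega>\<bar> \<ge> c} = prob {\<omega> \<in> space M. \<bar>b + Y \<omega>\<bar> \<ge> c}"
    by (simp add: measure_def vimage_def Int_def conj_commute)
  have "prob {\<omega> \<in> space M. \<bar>Y \<omega>\<bar> \<ge> c}
      \<le> prob ({\<omega> \<in> space M. \<bar>b + Y \<omega>\<bar> \<ge> c} \<union> {\<omega> \<in> space M. \<bar>b - Y \<omega>\<bar> \<ge> c})"
    by (rule finite_measure_mono) auto
  also have "\<dots> \<le> prob {\<omega> \<in> space M. \<bar>b + Y \<omega>\<bar> \<ge> c} + prob {\<omega> \<in> space M. \<bar>b - Y \<omega>\<bar> \<ge> c}"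
    by (rule measure_Un_le) measurable
  finally show ?thesis using sym by simp
qed

text \<open>The denominator 12 is 6 from the linearised Paley-Zygmund inequality times 2 from
  removing the shift \<open>b\<close>; the term \<open>r ^ 4 / 8\<close> is the normal fourth moment
  \<open>3 * r ^ 4\<close> divided by 24. Later \<open>r\<close> becomes the norm of a random
  coefficient vector, and a polynomial bound is what can then be averaged. For small
  \<open>r\<close> it is negative and claims nothing.\<close>

lemma normal_small_ball:
  assumes Y: "distributed M lborel Y (normal_density 0 (\<tau> * r))" and "\<tau> > 0" "r > 0"
  shows "(r\<^sup>2 - 1/4 - r ^ 4 / 8) / 12 \<le> prob {\<omega> \<in> space M. \<bar>b + Y \<omega>\<bar> \<ge> \<tau> / 2}"
proof -
  let ?S = "{\<omega> \<in> space M. \<bar>Y \<omega>\<bar> \<ge> \<tau> / 2}"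
  have [measurable]: "Y \<in> borel_measurable M"
    using distributed_measurable[OF Y] by simp
  have pos: "\<tau> * r > 0" using assms by simp
  note mom = normal_moments[OF Y pos]
  have int: "integrable M (indicat_real ?S)"
    by (rule integrable_real_indicator) (auto simp: emeasure_eq_measure)
  \<comment> \<open>Paley-Zygmund in linearised form: with \<open>z = Y\<^sup>2 / \<tau>\<^sup>2\<close> one has \<open>z \<le> z\<^sup>2 / 24 + 6\<close>; the constant
    \<open>24\<close> is optimal for the moments \<open>1\<close> and \<open>9\<close> that \<open>z\<close> and \<open>z\<^sup>2\<close> have after averaging over the input.\<close>
  have pointwise: "(Y \<omega>)\<^sup>2 / \<tau>\<^sup>2 - 1/4 - Y \<omega> ^ 4 / \<tau> ^ 4 / 24 \<le> 6 * indicat_real ?S \<omega>"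
    if "\<omega> \<in> space M" for \<omega>
  proof -
    define z where "z = (Y \<omega>)\<^sup>2 / \<tau>\<^sup>2"
    have z4: "Y \<omega> ^ 4 / \<tau> ^ 4 = z\<^sup>2"
      by (simp add: z_def power_divide flip: power_mult)
    have "z - 1/4 - z\<^sup>2 / 24 \<le> 6"
      using zero_le_power2[of "z - 12"] by (simp add: power2_eq_square algebra_simps)
    moreover have "z - 1/4 - z\<^sup>2 / 24 \<le> 0" if "\<not> \<bar>Y \<omega>\<bar> \<ge> \<tau> / 2"
    proof -
      have "\<bar>Y \<omega>\<bar> / \<tau> \<le> 1 / 2" using that \<open>\<tau> > 0\<close> by (simp add: field_simps)
      then have "(\<bar>Y \<omega>\<bar> / \<tau>)\<^sup>2 \<le> (1 / 2)\<^sup>2"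
        using \<open>\<tau> > 0\<close> by (intro power_mono) auto
      then have "z \<le> 1/4" by (simp add: z_def power_divide power2_eq_square)
      then show ?thesis by (smt (verit) zero_le_power2 divide_nonneg_pos)
    qed
    ultimately show ?thesis using that unfolding z4 z_def[symmetric] by (auto simp: indicator_def)
  qed
  have "expectation (\<lambda>\<omega>. (Y \<omega>)\<^sup>2 / \<tau>\<^sup>2 - 1/4 - Y \<omega> ^ 4 / \<tau> ^ 4 / 24)
      \<le> expectation (\<lambda>\<omega>. 6 * indicat_real ?S \<omega>)"
    by (rule integral_mono) (use mom(1) pointwise int in auto)
  also have "\<dots> = 6 * prob ?S" by simp
  also have "expectation (\<lambda>\<omega>. (Y \<omega>)\<^sup>2 / \<tau>\<^sup>2 - 1/4 - Y \<omega> ^ 4 / \<tau> ^ 4 / 24) = r\<^sup>2 - 1/4 - r ^ 4 / 8"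
    using mom \<open>\<tau> > 0\<close> by (simp add: power_mult_distrib prob_space)
  finally show ?thesis
    using normal_shift_prob_ge[OF Y pos, of "\<tau> / 2" b] by simp
qed

end

text \<open>The odd moments of the centred part vanish, so the fourth moment is
  \<open>b ^ 4 + 6 * b\<^sup>2 * s\<^sup>2 + 3 * s ^ 4\<close>. The kurtosis bound 3 of a centred
  normal variable thus survives a shift of its mean when moments are taken about zero.\<close>

lemma (in prob_space) gaussian_affine_moments:
  fixes X :: "'a \<Rightarrow> real^'d"
  assumes X: "gaussian M X 0 (\<sigma>\<^sup>2 *\<^sub>R mat 1)" and "\<sigma> > 0"
  shows "integrable M (\<lambda>\<omega>. (b + c \<bullet> X \<omega>)\<^sup>2)" and "integrable M (\<lambda>\<omega>. (b + c \<bullet> X \<omega>) ^ 4)"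
    and "expectation (\<lambda>\<omega>. (b + c \<bullet> X \<omega>)\<^sup>2) = b\<^sup>2 + (\<sigma> * norm c)\<^sup>2"
    and "expectation (\<lambda>\<omega>. (b + c \<bullet> X \<omega>) ^ 4) \<le> 3 * (b\<^sup>2 + (\<sigma> * norm c)\<^sup>2)\<^sup>2"
proof -
  define s where "s = \<sigma> * norm c"
  define Y where "Y \<omega> = c \<bullet> X \<omega>" for \<omega>
  have mom: "integrable M (\<lambda>\<omega>. Y \<omega> ^ k)" "expectation Y = 0" "expectation (\<lambda>\<omega>. (Y \<omega>)\<^sup>2) = s\<^sup>2"
      "expectation (\<lambda>\<omega>. Y \<omega> ^ 3) = 0" "expectation (\<lambda>\<omega>. Y \<omega> ^ 4) = 3 * s ^ 4" for k
  proof -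
    have "integrable M (\<lambda>\<omega>. Y \<omega> ^ k) \<and> expectation Y = 0 \<and> expectation (\<lambda>\<omega>. (Y \<omega>)\<^sup>2) = s\<^sup>2 \<and>
      expectation (\<lambda>\<omega>. Y \<omega> ^ 3) = 0 \<and> expectation (\<lambda>\<omega>. Y \<omega> ^ 4) = 3 * s ^ 4"
    \<comment> \<open>For \<open>c = 0\<close> the inner product is constantly zero and has no
      density, but the moment formulas persist with \<open>s = 0\<close>.\<close>
    proof (cases "c = 0")
      case True
      then show ?thesis by (simp add: Y_def[abs_def] s_def)
    next
      case False
      have "distributed M lborel Y (normal_density 0 s)"
        unfolding Y_def s_def using X \<open>\<sigma> > 0\<close> False by (rule gaussian_inner_normal)
      moreover have "s > 0" using False \<open>\<sigma> > 0\<close> by (simp add: s_def)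
      ultimately show ?thesis using normal_moments[of Y s] by blast
    qed
    then show "integrable M (\<lambda>\<omega>. Y \<omega> ^ k)" "expectation Y = 0" "expectation (\<lambda>\<omega>. (Y \<omega>)\<^sup>2) = s\<^sup>2"
      "expectation (\<lambda>\<omega>. Y \<omega> ^ 3) = 0" "expectation (\<lambda>\<omega>. Y \<omega> ^ 4) = 3 * s ^ 4" by blast+
  qed
  have int1: "integrable M Y" using mom(1)[of 1] by simp
  have e2: "(b + c \<bullet> X \<omega>)\<^sup>2 = b\<^sup>2 + 2 * b * Y \<omega> + (Y \<omega>)\<^sup>2" for \<omega>
    by (simp add: Y_def power2_eq_square algebra_simps)
  have e4: "(b + c \<bullet> X \<omega>) ^ 4 = b ^ 4 + 4 * b ^ 3 * Y \<omega> + 6 * b\<^sup>2 * (Y \<omega>)\<^sup>2 + 4 * b * Y \<omega> ^ 3 + Y \<omega> ^ 4" for \<omega>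
    by (simp add: Y_def eval_nat_numeral algebra_simps)
  show "integrable M (\<lambda>\<omega>. (b + c \<bullet> X \<omega>)\<^sup>2)" "integrable M (\<lambda>\<omega>. (b + c \<bullet> X \<omega>) ^ 4)"
    unfolding e2 e4 using mom(1) int1 by auto
  show "expectation (\<lambda>\<omega>. (b + c \<bullet> X \<omega>)\<^sup>2) = b\<^sup>2 + (\<sigma> * norm c)\<^sup>2"
    unfolding e2 s_def[symmetric] using mom int1 by (simp add: prob_space)
  have "expectation (\<lambda>\<omega>. (b + c \<bullet> X \<omega>) ^ 4) = b ^ 4 + 6 * b\<^sup>2 * s\<^sup>2 + 3 * s ^ 4"
    unfolding e4 using mom int1 by (simp add: prob_space)
  also have "\<dots> = 3 * (b\<^sup>2 + s\<^sup>2)\<^sup>2 - 2 * (b\<^sup>2)\<^sup>2"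
    by (simp add: eval_nat_numeral algebra_simps)
  also have "\<dots> \<le> 3 * (b\<^sup>2 + s\<^sup>2)\<^sup>2"
    by simp
  finally show "expectation (\<lambda>\<omega>. (b + c \<bullet> X \<omega>) ^ 4) \<le> 3 * (b\<^sup>2 + (\<sigma> * norm c)\<^sup>2)\<^sup>2"
    by (simp only: s_def)
qed

subsection \<open>Independence and conditional probabilities\<close>

text \<open>Independence is spelled out below because the library's \<open>indep_var\<close> forces both
  variables to have values in the same type.\<close>

lemma (in prob_space) independent_prob_ge:
  assumes X[measurable]: "X \<in> M \<rightarrow>\<^sub>M S" and Y[measurable]: "Y \<in> M \<rightarrow>\<^sub>M T"
    and indep: "\<And>A B. A \<in> sets S \<Longrightarrow> B \<in> sets T \<Longrightarrow>
      prob ((X -` A \<inter> space M) \<inter> (Y -` B \<inter> space M)) = prob (X -` A \<inter> space M) * prob (Y -` B \<inter> space M)"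
    and Q: "Q \<in> sets (S \<Otimes>\<^sub>M T)"
    and int: "integrable M (\<lambda>\<omega>. f (X \<omega>))"
    and bound: "\<And>x. x \<in> space S \<Longrightarrow> f x \<le> prob {\<omega> \<in> space M. (x, Y \<omega>) \<in> Q}"
  shows "expectation (\<lambda>\<omega>. f (X \<omega>)) \<le> prob {\<omega> \<in> space M. (X \<omega>, Y \<omega>) \<in> Q}"
proof -
  interpret DX: prob_space "distr M S X" by (rule prob_space_distr) fact
  interpret DY: prob_space "distr M T Y" by (rule prob_space_distr) fact
  have joint: "distr M S X \<Otimes>\<^sub>M distr M T Y = distr M (S \<Otimes>\<^sub>M T) (\<lambda>\<omega>. (X \<omega>, Y \<omega>))"
  proof (rule pair_measure_eqI)
    fix A B assume "A \<in> sets (distr M S X)" "B \<in> sets (distr M T Y)"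
    then have [measurable]: "A \<in> sets S" "B \<in> sets T" by simp_all
    have "(\<lambda>\<omega>. (X \<omega>, Y \<omega>)) -` (A \<times> B) \<inter> space M = (X -` A \<inter> space M) \<inter> (Y -` B \<inter> space M)"
      by auto
    then show "emeasure (distr M S X) A * emeasure (distr M T Y) B
        = emeasure (distr M (S \<Otimes>\<^sub>M T) (\<lambda>\<omega>. (X \<omega>, Y \<omega>))) (A \<times> B)"
      using indep[of A B]
      by (simp add: emeasure_distr emeasure_eq_measure ennreal_mult)
  qed (unfold_locales, simp cong: sets_pair_measure_cong)
  let ?h = "\<lambda>x. prob {\<omega> \<in> space M. (x, Y \<omega>) \<in> Q}"
  have Q': "Q \<in> sets (distr M S X \<Otimes>\<^sub>M distr M T Y)" "Q \<in> sets (S \<Otimes>\<^sub>M distr M T Y)"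
    using Q by (simp_all cong: sets_pair_measure_cong)
  have slice: "emeasure (distr M T Y) (Pair x -` Q) = ennreal (?h x)" if "x \<in> space S" for x
    using sets_Pair1[OF Q, of x]
    by (auto simp: emeasure_distr emeasure_eq_measure intro!: arg_cong[where f=prob])
  have hmeas: "?h \<in> borel_measurable S"
  proof -
    have "(\<lambda>x. enn2real (emeasure (distr M T Y) (Pair x -` Q))) \<in> borel_measurable S"
      using DY.measurable_emeasure_Pair[OF Q'(2)] by simp
    then show ?thesis
      by (rule measurable_cong[THEN iffD1, rotated]) (simp add: slice)
  qed
  have hX[measurable]: "(\<lambda>\<omega>. ?h (X \<omega>)) \<in> borel_measurable M"
    using measurable_compose[OF X hmeas] .
  have hint: "integrable M (\<lambda>\<omega>. ?h (X \<omega>))"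
    by (rule integrable_const_bound[of _ 1]) auto
  \<comment> \<open>Fubini for the product law: fixing the value of \<open>X\<close> leaves the law
    of \<open>Y\<close> unchanged, so this probability is the mean of
    \<open>?h (X \<omega>)\<close>.\<close>
  have "ennreal (prob {\<omega> \<in> space M. (X \<omega>, Y \<omega>) \<in> Q})
      = emeasure (distr M S X \<Otimes>\<^sub>M distr M T Y) Q"
    unfolding joint using Q
    by (auto simp: emeasure_distr emeasure_eq_measure intro!: arg_cong[where f=prob])
  also have "\<dots> = (\<integral>\<^sup>+x. emeasure (distr M T Y) (Pair x -` Q) \<partial>distr M S X)"
    by (rule DY.emeasure_pair_measure_alt[OF Q'(1)])
  also have "\<dots> = (\<integral>\<^sup>+\<omega>. emeasure (distr M T Y) (Pair (X \<omega>) -` Q) \<partial>M)"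
    using DY.measurable_emeasure_Pair[OF Q'(2)] by (subst nn_integral_distr) auto
  also have "\<dots> = (\<integral>\<^sup>+\<omega>. ennreal (?h (X \<omega>)) \<partial>M)"
    using measurable_space[OF X] by (intro nn_integral_cong slice)
  also have "\<dots> = ennreal (expectation (\<lambda>\<omega>. ?h (X \<omega>)))"
    by (rule nn_integral_eq_integral[OF hint]) simp
  finally have "prob {\<omega> \<in> space M. (X \<omega>, Y \<omega>) \<in> Q} = expectation (\<lambda>\<omega>. ?h (X \<omega>))"
    by (simp add: integral_nonneg_AE)
  then show ?thesis
    using integral_mono[OF int hint] bound measurable_space[OF X] by simp
qed

text \<open>Take for \<open>B\<close> the set where the conditional probability falls below
  \<open>p\<close>. The deficit \<open>h\<close> on it is nonnegative, yet its integral
  \<open>p * prob B - prob (B \<inter> E)\<close> is at most 0 by \<open>bound\<close>; hence the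
  deficit vanishes almost everywhere.\<close>

lemma (in prob_space) cond_probability_ge:
  assumes sub: "subalgebra M F" and E: "E \<in> events"
    and bound: "\<And>B. B \<in> sets F \<Longrightarrow> p * prob B \<le> prob (B \<inter> E)"
  shows "AE \<omega> in M. p \<le> cond_probability M F E \<omega>"
proof -
  interpret F: finite_measure_subalgebra M F by unfold_locales fact
  let ?g = "real_cond_exp M F (indicat_real E)"
  define B where "B = {\<omega> \<in> space F. ?g \<omega> < p}"
  have BF: "B \<in> sets F" unfolding B_def by measurable
  then have BM[measurable]: "B \<in> events" using sub by (auto simp: subalgebra_def)
  have spF: "space F = space M" using sub by (simp add: subalgebra_def)
  have intE: "integrable M (indicat_real E)"
    using E by (simp add: integrable_real_indicator emeasure_eq_measure)
  have int: "integrable M ?g" by (rule F.real_cond_exp_int(1)[OF intE])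
  define h where "h \<omega> = indicat_real B \<omega> * (p - ?g \<omega>)" for \<omega>
  have hint: "integrable M h"
    unfolding h_def using integrable_mult_indicator[OF BM, of "\<lambda>\<omega>. p - ?g \<omega>"] int by simp
  have hnn: "0 \<le> h \<omega>" for \<omega>
    by (auto simp: h_def B_def indicator_def)
  have "(\<integral>\<omega>\<in>B. ?g \<omega> \<partial>M) = (\<integral>\<omega>\<in>B. indicat_real E \<omega> \<partial>M)"
    using F.real_cond_exp_intA[OF intE BF] by simp
  also have "\<dots> = prob (B \<inter> E)"
    using E by (simp add: set_lebesgue_integral_def indicator_inter_arith[symmetric])
  finally have "(\<integral>\<omega>. indicat_real B \<omega> * ?g \<omega> \<partial>M) = prob (B \<inter> E)"
    by (simp add: set_lebesgue_integral_def)
  moreover have "integrable M (\<lambda>\<omega>. indicat_real B \<omega> * ?g \<omega>)"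
    using integrable_mult_indicator[OF BM int] by simp
  ultimately have "integral\<^sup>L M h = p * prob B - prob (B \<inter> E)"
    unfolding h_def by (simp add: right_diff_distrib integrable_real_indicator emeasure_eq_measure)
  then have "integral\<^sup>L M h = 0"
    using bound[OF BF] Bochner_Integration.integral_nonneg[of M h] hnn by simp
  then have "AE \<omega> in M. h \<omega> = 0"
    using integral_nonneg_eq_0_iff_AE[OF hint] hnn by simp
  then show ?thesis
    unfolding cond_probability_def
    by (rule AE_mp) (auto intro!: AE_I2 simp: h_def B_def spF indicator_def split: if_splits)
qed

lemma Int_stable_INT:
  assumes "finite K" "K \<noteq> {}" "Int_stable G" "\<And>k. k \<in> K \<Longrightarrow> A k \<in> G"
  shows "(\<Inter>k\<in>K. A k) \<in> G"
  using assms by (induction K rule: finite_ne_induct) (auto intro: Int_stableD)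

text \<open>A finite intersection over pairs is regrouped by first index. Each group's intersection
  lies in \<open>G i\<close> by intersection stability, so outer independence separates the groups
  and inner independence then splits each of them.\<close>

lemma (in prob_space) indep_sets_Sigma:
  assumes outer: "indep_sets G I" and inner: "\<And>i. i \<in> I \<Longrightarrow> indep_sets (F i) (J i)"
    and sub: "\<And>i j. i \<in> I \<Longrightarrow> j \<in> J i \<Longrightarrow> F i j \<subseteq> G i"
    and stable: "\<And>i. i \<in> I \<Longrightarrow> Int_stable (G i)"
  shows "indep_sets (\<lambda>(i, j). F i j) (Sigma I J)"
proof (rule indep_setsI)
  show "(case k of (i, j) \<Rightarrow> F i j) \<subseteq> events" if "k \<in> Sigma I J" for k
    using that inner by (auto simp: indep_sets_def)
next
  fix A K
  assume K: "K \<noteq> {}" "K \<subseteq> Sigma I J" "finite K" and A: "\<forall>k\<in>K. A k \<in> (case k of (i, j) \<Rightarrow> F i j)"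
  let ?L = "fst ` K" and ?R = "\<lambda>i. {j. (i, j) \<in> K}"
  have L: "?L \<noteq> {}" "?L \<subseteq> I" "finite ?L" using K by auto
  have finR: "finite (?R i)" for i
    by (rule finite_subset[of _ "snd ` K"]) (use K in \<open>force+\<close>)
  have R: "?R i \<noteq> {}" "?R i \<subseteq> J i" if "i \<in> ?L" for i
    using that K by auto
  have inG: "(\<Inter>j\<in>?R i. A (i, j)) \<in> G i" if "i \<in> ?L" for i
  proof -
    have "A (i, j) \<in> G i" if "j \<in> ?R i" for j
      using that A K sub by fastforce
    then show ?thesis
      using that L(2) finR R(1) by (intro Int_stable_INT stable) auto
  qed
  have K_eq: "K = Sigma ?L ?R" by force
  have "prob (\<Inter>k\<in>K. A k) = prob (\<Inter>i\<in>?L. \<Inter>j\<in>?R i. A (i, j))"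
    by (rule arg_cong[where f=prob]) force
  also have "\<dots> = (\<Prod>i\<in>?L. prob (\<Inter>j\<in>?R i. A (i, j)))"
    using inG by (intro indep_setsD[OF outer L(2,1,3)]) blast
  also have "\<dots> = (\<Prod>i\<in>?L. \<Prod>j\<in>?R i. prob (A (i, j)))"
  proof (rule prod.cong[OF refl])
    fix i assume i: "i \<in> ?L"
    have "\<forall>j\<in>?R i. A (i, j) \<in> F i j" using A by auto
    then show "prob (\<Inter>j\<in>?R i. A (i, j)) = (\<Prod>j\<in>?R i. prob (A (i, j)))"
      using i L(2) by (intro indep_setsD[OF inner R(2,1)[OF i] finR]) auto
  qed
  also have "\<dots> = (\<Prod>k\<in>K. prob (A k))"
    using L(3) finR by (subst K_eq, subst prod.Sigma) auto
  finally show "prob (\<Inter>k\<in>K. A k) = (\<Prod>k\<in>K. prob (A k))" .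
qed

subsection \<open>Projections of the lifted state\<close>

text \<open>The vector a(u) of the overview: the \<open>None\<close> block of \<open>v\<close> plus
  the combination of its other blocks with weights \<open>u $ k / \<sigma>\<close>. Each entry is
  written as a constant plus an inner product with \<open>u\<close>, the form that
  \<open>gaussian_affine_moments\<close> treats.\<close>

definition lift_coeff :: "real \<Rightarrow> real^('m::finite option \<times> 'n::finite) \<Rightarrow> real^'m \<Rightarrow> real^'n" where
  "lift_coeff \<sigma> v u = (\<chi> j. v $ (None, j) + (\<chi> k. inverse \<sigma> * v $ (Some k, j)) \<bullet> u)"

lemma sum_option_prod:
  fixes f :: "'m::finite option \<times> 'n::finite \<Rightarrow> 'b::comm_monoid_add"
  shows "(\<Sum>i\<in>UNIV. f i) = (\<Sum>j\<in>UNIV. f (None, j) + (\<Sum>k\<in>UNIV. f (Some k, j)))"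
proof -
  have "(\<Sum>i\<in>UNIV. f i) = (\<Sum>o'\<in>UNIV. \<Sum>j\<in>UNIV. f (o', j))"
    by (simp add: sum.cartesian_product UNIV_Times_UNIV[symmetric] del: UNIV_Times_UNIV)
  also have "\<dots> = (\<Sum>j\<in>UNIV. \<Sum>o'\<in>UNIV. f (o', j))"
    by (rule sum.swap)
  also have "\<dots> = (\<Sum>j\<in>UNIV. f (None, j) + (\<Sum>k\<in>UNIV. f (Some k, j)))"
    by (simp add: UNIV_option_conv sum.reindex)
  finally show ?thesis .
qed

lemma inner_lift_state: "v \<bullet> lift_state \<sigma> x u = lift_coeff \<sigma> v u \<bullet> x"
proof -
  have "v \<bullet> lift_state \<sigma> x u
      = (\<Sum>j\<in>UNIV. v $ (None, j) * x $ j + (\<Sum>k\<in>UNIV. v $ (Some k, j) * (inverse \<sigma> * u $ k * x $ j)))"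
    by (simp add: inner_vec_def lift_state_def sum_option_prod)
  also have "\<dots> = lift_coeff \<sigma> v u \<bullet> x"
    by (simp add: inner_vec_def lift_coeff_def algebra_simps sum_distrib_left)
  finally show ?thesis .
qed

text \<open>Cauchy-Schwarz with probability weights \<open>p\<close>. It reduces the fourth moment
  of the norm of a vector to fourth moments of single coordinates; the coordinates of a(u) share the
  same u, and their mixed moments are thereby avoided. Since division by 0 gives 0, the right-hand
  side misses coordinates of weight 0, so \<open>a\<close> must vanish there.\<close>

lemma sum_square_le_weighted:
  fixes p a :: "'n::finite \<Rightarrow> real"
  assumes p: "\<And>j. p j \<ge> 0" "(\<Sum>j\<in>UNIV. p j) = 1" and zero: "\<And>j. p j = 0 \<Longrightarrow> a j = 0"
  shows "(\<Sum>j\<in>UNIV. (a j)\<^sup>2)\<^sup>2 \<le> (\<Sum>j\<in>UNIV. a j ^ 4 / p j)"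
proof -
  have "(\<Sum>j\<in>UNIV. sqrt (p j) * ((a j)\<^sup>2 / sqrt (p j)))\<^sup>2
      \<le> (\<Sum>j\<in>UNIV. (sqrt (p j))\<^sup>2) * (\<Sum>j\<in>UNIV. ((a j)\<^sup>2 / sqrt (p j))\<^sup>2)"
    by (rule Cauchy_Schwarz_ineq_sum)
  moreover have "sqrt (p j) * ((a j)\<^sup>2 / sqrt (p j)) = (a j)\<^sup>2" for j
    using zero[of j] by (cases "p j = 0") auto
  moreover have "((a j)\<^sup>2 / sqrt (p j))\<^sup>2 = a j ^ 4 / p j" for j
    using p(1)[of j] by (simp add: power_divide flip: power_mult)
  ultimately show ?thesis using p by simp
qed

text \<open>The weight \<open>p j\<close> is the second moment of coordinate \<open>j\<close>. The
  factor \<open>inverse \<sigma>\<close> cancels the input variance, so the weights sum to the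
  squared norm of \<open>v\<close>, which is 1. Weighted by \<open>1 / p j\<close>, coordinate
  \<open>j\<close> contributes at most \<open>3 * (p j)\<^sup>2 / p j\<close> to the fourth
  moment.\<close>

lemma (in prob_space) lift_coeff_moments:
  fixes U :: "'a \<Rightarrow> real^'m" and v :: "real^('m option \<times> 'n::finite)"
  assumes U: "gaussian M U 0 (\<sigma>\<^sup>2 *\<^sub>R mat 1)" and "\<sigma> > 0" and v: "norm v = 1"
  shows "integrable M (\<lambda>\<omega>. (norm (lift_coeff \<sigma> v (U \<omega>)))\<^sup>2)"
    and "integrable M (\<lambda>\<omega>. norm (lift_coeff \<sigma> v (U \<omega>)) ^ 4)"
    and "expectation (\<lambda>\<omega>. (norm (lift_coeff \<sigma> v (U \<omega>)))\<^sup>2) = 1"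
    and "expectation (\<lambda>\<omega>. norm (lift_coeff \<sigma> v (U \<omega>)) ^ 4) \<le> 3"
proof -
  define c where "c j = (\<chi> k. inverse \<sigma> * v $ (Some k, j))" for j
  define b where "b j = v $ (None, j)" for j
  define p where "p j = (b j)\<^sup>2 + (\<sigma> * norm (c j))\<^sup>2" for j
  define a where "a j \<omega> = b j + c j \<bullet> U \<omega>" for j \<omega>
  have [measurable]: "U \<in> borel_measurable M" using U by (rule gaussian_measurable)
  have mom: "integrable M (\<lambda>\<omega>. (a j \<omega>)\<^sup>2)" "integrable M (\<lambda>\<omega>. a j \<omega> ^ 4)"
      "expectation (\<lambda>\<omega>. (a j \<omega>)\<^sup>2) = p j" "expectation (\<lambda>\<omega>. a j \<omega> ^ 4) \<le> 3 * (p j)\<^sup>2" for j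
    unfolding a_def p_def by (rule gaussian_affine_moments[OF U \<open>\<sigma> > 0\<close>])+
  have p_nn: "p j \<ge> 0" for j by (simp add: p_def)
  have norm_c: "(\<sigma> * norm (c j))\<^sup>2 = (\<Sum>k\<in>UNIV. (v $ (Some k, j))\<^sup>2)" for j
    using \<open>\<sigma> > 0\<close>
    by (simp add: c_def norm_vec_def L2_set_def sum_nonneg power_mult_distrib sum_distrib_left field_simps)
  have "(norm v)\<^sup>2 = (\<Sum>j\<in>UNIV. p j)"
    unfolding p_def b_def norm_c
    by (simp add: norm_vec_def L2_set_def sum_nonneg sum_option_prod)
  then have p_sum: "(\<Sum>j\<in>UNIV. p j) = 1" using v by simp
  have norm_a: "(norm (lift_coeff \<sigma> v (U \<omega>)))\<^sup>2 = (\<Sum>j\<in>UNIV. (a j \<omega>)\<^sup>2)" for \<omega>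
    by (simp add: lift_coeff_def a_def b_def c_def norm_vec_def L2_set_def sum_nonneg)
  \<comment> \<open>Summands with \<open>p j = 0\<close> vanish identically, so the junk value \<open>a j \<omega> ^ 4 / 0 = 0\<close> is harmless.\<close>
  have le: "norm (lift_coeff \<sigma> v (U \<omega>)) ^ 4 \<le> (\<Sum>j\<in>UNIV. a j \<omega> ^ 4 / p j)" for \<omega>
  proof -
    have "a j \<omega> = 0" if "p j = 0" for j
      using that \<open>\<sigma> > 0\<close> by (simp add: p_def a_def sum_power2_eq_zero_iff)
    then have "(\<Sum>j\<in>UNIV. (a j \<omega>)\<^sup>2)\<^sup>2 \<le> (\<Sum>j\<in>UNIV. a j \<omega> ^ 4 / p j)"
      by (intro sum_square_le_weighted p_nn p_sum)
    then show ?thesis by (simp add: norm_a[symmetric] flip: power_mult)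
  qed
  have int_sum: "integrable M (\<lambda>\<omega>. \<Sum>j\<in>UNIV. a j \<omega> ^ 4 / p j)"
    using mom(2) by auto
  show "integrable M (\<lambda>\<omega>. (norm (lift_coeff \<sigma> v (U \<omega>)))\<^sup>2)"
    unfolding norm_a using mom(1) by auto
  show int4: "integrable M (\<lambda>\<omega>. norm (lift_coeff \<sigma> v (U \<omega>)) ^ 4)"
  proof (rule Bochner_Integration.integrable_bound[OF int_sum])
    have "norm (lift_coeff \<sigma> v (U \<omega>)) ^ 4 = (\<Sum>j\<in>UNIV. (a j \<omega>)\<^sup>2)\<^sup>2" for \<omega>
      by (simp add: norm_a[symmetric] flip: power_mult)
    then show "(\<lambda>\<omega>. norm (lift_coeff \<sigma> v (U \<omega>)) ^ 4) \<in> borel_measurable M"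
      unfolding a_def by simp
  qed (use le in \<open>auto intro: order_trans[OF _ abs_ge_self]\<close>)
  show "expectation (\<lambda>\<omega>. (norm (lift_coeff \<sigma> v (U \<omega>)))\<^sup>2) = 1"
    unfolding norm_a using mom(1,3) p_sum by simp
  have "expectation (\<lambda>\<omega>. norm (lift_coeff \<sigma> v (U \<omega>)) ^ 4)
      \<le> expectation (\<lambda>\<omega>. \<Sum>j\<in>UNIV. a j \<omega> ^ 4 / p j)"
    by (rule integral_mono[OF int4 int_sum le])
  also have "\<dots> = (\<Sum>j\<in>UNIV. expectation (\<lambda>\<omega>. a j \<omega> ^ 4) / p j)"
    using mom(2) by simp
  also have "\<dots> \<le> (\<Sum>j\<in>UNIV. 3 * p j)"
  proof (rule sum_mono)
    fix j
    have "expectation (\<lambda>\<omega>. a j \<omega> ^ 4) / p j \<le> 3 * (p j)\<^sup>2 / p j"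
      using mom(4) p_nn by (rule divide_right_mono)
    also have "\<dots> = 3 * p j" by (simp add: power2_eq_square)
    finally show "expectation (\<lambda>\<omega>. a j \<omega> ^ 4) / p j \<le> 3 * p j" .
  qed
  also have "\<dots> = 3" using p_sum by (simp flip: sum_distrib_left)
  finally show "expectation (\<lambda>\<omega>. norm (lift_coeff \<sigma> v (U \<omega>)) ^ 4) \<le> 3" .
qed

lemma borel_measurable_lift_coeff [measurable]: "lift_coeff \<sigma> v \<in> borel_measurable borel"
  unfolding lift_coeff_def
  by (intro borel_measurable_continuous_onI continuous_intros)

text \<open>For a fixed input, the projection is a constant plus a centred normal variable with
  standard deviation \<open>\<sigma>w\<close> times the norm of the coefficient vector, so
  \<open>normal_small_ball\<close> applies; independence then permits averaging over the
  input.\<close>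

lemma (in prob_space) lift_coeff_small_ball:
  fixes U :: "'a \<Rightarrow> real^'m" and W :: "'a \<Rightarrow> real^'n" and v :: "real^('m option \<times> 'n::finite)"
  assumes U: "gaussian M U 0 (\<sigma>u\<^sup>2 *\<^sub>R mat 1)" and "\<sigma>u > 0"
    and W: "gaussian M W 0 (\<sigma>w\<^sup>2 *\<^sub>R mat 1)" and "\<sigma>w > 0"
    and indep: "\<And>A B. A \<in> sets borel \<Longrightarrow> B \<in> sets borel \<Longrightarrow>
      prob ((U -` A \<inter> space M) \<inter> (W -` B \<inter> space M)) = prob (U -` A \<inter> space M) * prob (W -` B \<inter> space M)"
    and v: "norm v = 1"
  shows "1/32 \<le> prob {\<omega> \<in> space M. \<bar>lift_coeff \<sigma>u v (U \<omega>) \<bullet> (\<mu> + W \<omega>)\<bar> \<ge> \<sigma>w / 2}"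
proof -
  let ?f = "\<lambda>u. ((norm (lift_coeff \<sigma>u v u))\<^sup>2 - 1/4 - norm (lift_coeff \<sigma>u v u) ^ 4 / 8) / 12"
  let ?Q = "{(u, w). \<bar>lift_coeff \<sigma>u v u \<bullet> (\<mu> + w)\<bar> \<ge> \<sigma>w / 2}"
  note mom = lift_coeff_moments[OF U \<open>\<sigma>u > 0\<close> v]
  have Q: "?Q \<in> sets (borel \<Otimes>\<^sub>M borel)"
  proof -
    have "?Q = {y \<in> space (borel \<Otimes>\<^sub>M borel). \<bar>lift_coeff \<sigma>u v (fst y) \<bullet> (\<mu> + snd y)\<bar> \<ge> \<sigma>w / 2}"
      by (auto simp: space_pair_measure)
    also have "\<dots> \<in> sets (borel \<Otimes>\<^sub>M borel)" by measurable
    finally show ?thesis .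
  qed
  \<comment> \<open>With second moment 1 and fourth moment at most 3, the mean is at least (1 - 1/4
    - 3/8) / 12 = 1/32.\<close>
  have "1/32 \<le> expectation (\<lambda>\<omega>. ?f (U \<omega>))"
    using mom by (simp add: prob_space)
  also have "\<dots> \<le> prob {\<omega> \<in> space M. (U \<omega>, W \<omega>) \<in> ?Q}"
  proof (rule independent_prob_ge[OF gaussian_measurable[OF U] gaussian_measurable[OF W] indep Q])
    show "integrable M (\<lambda>\<omega>. ?f (U \<omega>))" using mom(1,2) by auto
    fix u :: "real^'m"
    let ?a = "lift_coeff \<sigma>u v u"
    show "?f u \<le> prob {\<omega> \<in> space M. (u, W \<omega>) \<in> ?Q}"
    \<comment> \<open>A vanishing coefficient leaves no Gaussian part, but there \<open>?f u\<close>
      equals -1/48.\<close>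
    proof (cases "?a = 0")
      case True
      have "?f u \<le> 0" using True by simp
      then show ?thesis using measure_nonneg order_trans by blast
    next
      case False
      then show ?thesis
        using normal_small_ball[OF gaussian_inner_normal[OF W \<open>\<sigma>w > 0\<close> False] \<open>\<sigma>w > 0\<close>, of "?a \<bullet> \<mu>"]
        by (simp add: inner_add_right)
    qed
  qed
  finally show ?thesis by simp
qed

subsection \<open>The bilinear system\<close>

lemma sets_vimage_algebra_borel: "sets (vimage_algebra S X borel) = {X -` B \<inter> S | B. B \<in> sets borel}"
  by (rule sets_vimage_algebra2) simp

lemma sets_vimage_borel_subset:
  assumes "X \<in> borel_measurable N" and "space N = S"
  shows "sets (vimage_algebra S X borel) \<subseteq> sets N"
  using assms by (auto simp: sets_vimage_algebra_borel)

lemma measurable_if_sets_vimage_subset: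
  assumes "sets (vimage_algebra (space N) X borel) \<subseteq> sets N"
  shows "X \<in> borel_measurable N"
  using assms by (auto intro!: measurableI simp: sets_vimage_algebra_borel)

lemma gen_events_subset:
  assumes "\<And>i. i \<in> I \<Longrightarrow> X i \<in> borel_measurable N" and "space N = space M"
  shows "gen_events M I X \<subseteq> sets N"
  unfolding gen_events_def
  by (subst assms(2)[symmetric], rule sets.sigma_sets_subset)
    (intro UN_least sets_vimage_borel_subset; use assms in simp)

lemma gen_events_Pow: "gen_events M I X \<subseteq> Pow (space M)"
proof -
  have "(\<Union>i\<in>I. sets (vimage_algebra (space M) (X i) borel)) \<subseteq> Pow (space M)"
    by (auto simp: sets_vimage_algebra_borel)
  then show ?thesis
    unfolding gen_events_def by (auto dest: sigma_sets_into_sp)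
qed

lemma Int_stable_gen_events: "Int_stable (gen_events M I X)"
proof -
  have "sigma_algebra (space M) (gen_events M I X)"
    unfolding gen_events_def
    by (rule sigma_algebra_sigma_sets) (auto simp: sets_vimage_algebra_borel)
  then show ?thesis
    by (auto intro: algebra.Int_stable sigma_algebra.axioms(1))
qed

lemma space_nat_filtration: "space (nat_filtration M x u w t) = space M"
  unfolding nat_filtration_def by (rule space_measure_of) (simp add: gen_events_Pow)

lemma sets_nat_filtration:
  "sets (nat_filtration M x u w t)
    = sigma_sets (space M) (gen_events M {0..t} x \<union> gen_events M {0..t} u \<union> gen_events M {1..t} w)"
  unfolding nat_filtration_def by (rule sets_measure_of) (simp add: gen_events_Pow)

lemma sets_nat_filtration_subset:
  assumes "space N = space M"
    and "\<And>s. s \<le> t \<Longrightarrow> x s \<in> borel_measurable N" "\<And>s. s \<le> t \<Longrightarrow> u s \<in> borel_measurable N"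
    and "\<And>s. 1 \<le> s \<Longrightarrow> s \<le> t \<Longrightarrow> w s \<in> borel_measurable N"
  shows "sets (nat_filtration M x u w t) \<subseteq> sets N"
  unfolding sets_nat_filtration
  by (subst assms(1)[symmetric], rule sets.sigma_sets_subset)
    (intro Un_least gen_events_subset; use assms in simp)

lemma sets_vimage_subset_gen_events:
  "i \<in> I \<Longrightarrow> sets (vimage_algebra (space M) (X i) borel) \<subseteq> gen_events M I X"
  unfolding gen_events_def by (intro subsetI sigma_sets.Basic) blast

lemma measurable_gen_events:
  assumes "gen_events M I X \<subseteq> sets N" and "space N = space M" and "i \<in> I"
  shows "X i \<in> borel_measurable N"
proof (rule measurable_if_sets_vimage_subset)
  show "sets (vimage_algebra (space N) (X i) borel) \<subseteq> sets N"
    using sets_vimage_subset_gen_events[OF assms(3), of M X] assms by auto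
qed

lemma measurable_nat_filtration:
  shows "s \<le> t \<Longrightarrow> x s \<in> borel_measurable (nat_filtration M x u w t)"
    and "s \<le> t \<Longrightarrow> u s \<in> borel_measurable (nat_filtration M x u w t)"
    and "1 \<le> s \<Longrightarrow> s \<le> t \<Longrightarrow> w s \<in> borel_measurable (nat_filtration M x u w t)"
proof -
  let ?N = "nat_filtration M x u w t"
  have sub: "gen_events M {0..t} x \<subseteq> sets ?N" "gen_events M {0..t} u \<subseteq> sets ?N"
      "gen_events M {1..t} w \<subseteq> sets ?N"
    unfolding sets_nat_filtration by (intro subsetI sigma_sets.Basic; simp)+
  show "s \<le> t \<Longrightarrow> x s \<in> borel_measurable ?N" "s \<le> t \<Longrightarrow> u s \<in> borel_measurable ?N"
      "1 \<le> s \<Longrightarrow> s \<le> t \<Longrightarrow> w s \<in> borel_measurable ?N"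
    using sub[THEN measurable_gen_events, OF space_nat_filtration] by simp_all
qed

section \<open>Dynamics, independence of past and future, and the one-step bound\<close>

locale bilinear_system = prob_space M for M :: "'a measure" +
  fixes A0 :: "real^'n^'n" and A :: "'m::finite \<Rightarrow> real^'n^'n"
    and \<sigma>u \<sigma>w :: real
    and x :: "nat \<Rightarrow> 'a \<Rightarrow> real^'n"
    and u :: "nat \<Rightarrow> 'a \<Rightarrow> real^'m"
    and w :: "nat \<Rightarrow> 'a \<Rightarrow> real^'n"
  assumes \<sigma>u_pos: "\<sigma>u > 0" and \<sigma>w_pos: "\<sigma>w > 0"
    and x0_meas: "x 0 \<in> borel_measurable M"
    and system: "\<And>t \<omega>. \<omega> \<in> space M \<Longrightarrow>
      x (Suc t) \<omega> = A0 *v x t \<omega> + (\<Sum>k\<in>UNIV. (u t \<omega> $ k) *\<^sub>R (A k *v x t \<omega>)) + w (Suc t) \<omega>"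
    and u_gaussian: "\<And>t. gaussian M (u t) 0 (\<sigma>u\<^sup>2 *\<^sub>R mat 1)"
    and u_indep: "indep_vars (\<lambda>_. borel) u UNIV"
    and w_gaussian: "\<And>t. t \<ge> 1 \<Longrightarrow> gaussian M (w t) 0 (\<sigma>w\<^sup>2 *\<^sub>R mat 1)"
    and w_indep: "indep_vars (\<lambda>_. borel) w {1..}"
    and mutual_indep: "indep_sets
      (\<lambda>i. [gen_events M UNIV u, gen_events M {1..} w, gen_events M {0} x] ! i) {..<3::nat}"
begin

abbreviation "\<F> \<equiv> nat_filtration M x u w"

definition drift :: "nat \<Rightarrow> 'a \<Rightarrow> real^'n" where
  "drift t \<omega> = A0 *v x t \<omega> + (\<Sum>k\<in>UNIV. (u t \<omega> $ k) *\<^sub>R (A k *v x t \<omega>))"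

lemma u_meas: "u t \<in> borel_measurable M"
  using u_gaussian by (rule gaussian_measurable)

lemma w_meas: "t \<ge> 1 \<Longrightarrow> w t \<in> borel_measurable M"
  using w_gaussian by (blast intro: gaussian_measurable)

lemma borel_measurable_matrix_vector_mult [measurable]:
  fixes B :: "real^'p^'q"
  shows "(\<lambda>y. B *v y) \<in> borel_measurable borel"
  by (intro borel_measurable_continuous_onI continuous_intros)

lemma drift_measurable:
  assumes [measurable]: "x t \<in> borel_measurable N" "u t \<in> borel_measurable N"
  shows "drift t \<in> borel_measurable N"
  unfolding drift_def by measurable

text \<open>Unrolling the recursion makes the state a function of \<open>x 0\<close>, earlier inputs
  and noise up to the present. The sigma-algebra \<open>N\<close> is left free because the lemma
  serves both for \<open>M\<close> itself and for the one generated by the past sources.\<close>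

lemma x_measurable:
  assumes N: "space N = space M" and "x 0 \<in> borel_measurable N"
    and "\<And>s. s < t \<Longrightarrow> u s \<in> borel_measurable N" and "\<And>s. s < t \<Longrightarrow> w (Suc s) \<in> borel_measurable N"
  shows "x t \<in> borel_measurable N"
  using assms(3-)
proof (induction t)
  case 0
  then show ?case using assms(2) by simp
next
  case (Suc t)
  have [measurable]: "drift t \<in> borel_measurable N" "w (Suc t) \<in> borel_measurable N"
    using Suc by (auto intro!: drift_measurable)
  have "(\<lambda>\<omega>. drift t \<omega> + w (Suc t) \<omega>) \<in> borel_measurable N" by measurable
  then show ?case
    by (rule measurable_cong[THEN iffD1, rotated]) (simp add: N system drift_def)
qed

lemma is_filtration: "is_filtration M \<F>"
proof -
  have "sets (\<F> t) \<subseteq> sets M" for t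
    by (rule sets_nat_filtration_subset) (auto intro!: x_measurable x0_meas u_meas w_meas)
  moreover have "sets (\<F> s) \<subseteq> sets (\<F> t)" if "s \<le> t" for s t
    by (rule sets_nat_filtration_subset)
      (use that in \<open>auto intro!: measurable_nat_filtration simp: space_nat_filtration\<close>)
  ultimately show ?thesis
    by (simp add: is_filtration_def subalgebra_def filtration_def space_nat_filtration)
qed

text \<open>The tags 0, 1 and 2 stand for input, noise and state, so that all primitive random
  vectors form one family which can be regrouped freely. Of the states only the initial one, index
  \<open>(2, 0)\<close>, enters this family.\<close>

definition source :: "nat \<times> nat \<Rightarrow> 'a set set" where
  "source = (\<lambda>(i, t). [sets (vimage_algebra (space M) (u t) borel),
     sets (vimage_algebra (space M) (w t) borel), sets (vimage_algebra (space M) (x t) borel)] ! i)"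

text \<open>Independence is assumed on two levels, between the three groups and between times within
  a group; \<open>indep_sets_Sigma\<close> merges the levels.\<close>

lemma source_indep: "indep_sets source ({0} \<times> UNIV \<union> {1} \<times> {1..} \<union> {(2, 0)})"
proof -
  let ?J = "\<lambda>i::nat. [UNIV, {1..}, {0}] ! i :: nat set"
  have lt3: "i = 0 \<or> i = 1 \<or> i = 2" if "i \<in> {..<3}" for i :: nat
    using that by auto
  have u': "indep_sets (\<lambda>t. sets (vimage_algebra (space M) (u t) borel)) UNIV"
    using u_indep by (simp add: indep_vars_def2 sets_vimage_algebra_borel)
  have w': "indep_sets (\<lambda>t. sets (vimage_algebra (space M) (w t) borel)) {1..}"
    using w_indep by (simp add: indep_vars_def2 sets_vimage_algebra_borel)
  have x': "indep_sets (\<lambda>t. sets (vimage_algebra (space M) (x t) borel)) {0}"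
  proof (rule indep_setsI)
    show "sets (vimage_algebra (space M) (x t) borel) \<subseteq> events" if "t \<in> {0}" for t
      using that sets_vimage_borel_subset[OF x0_meas refl] by simp
  qed (auto simp: subset_singleton_iff)
  have "indep_sets (\<lambda>(i, t). source (i, t)) (Sigma {..<3} ?J)"
  proof (rule indep_sets_Sigma[OF mutual_indep])
    fix i :: nat assume "i \<in> {..<3}"
    note i = lt3[OF this]
    show "indep_sets (\<lambda>t. source (i, t)) (?J i)"
      using i u' w' x' by (auto simp: source_def)
    show "source (i, t) \<subseteq> [gen_events M UNIV u, gen_events M {1..} w, gen_events M {0} x] ! i"
      if "t \<in> ?J i" for t
      using i that sets_vimage_subset_gen_events[of t UNIV M u] sets_vimage_subset_gen_events[of t "{1..}" M w]
        sets_vimage_subset_gen_events[of t "{0}" M x]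
      by (elim disjE) (simp_all add: source_def)
    show "Int_stable ([gen_events M UNIV u, gen_events M {1..} w, gen_events M {0} x] ! i)"
      using i by (auto simp: Int_stable_gen_events)
  qed
  moreover have "Sigma {..<3} ?J = {0} \<times> UNIV \<union> {1} \<times> {1..} \<union> {(2, 0)}"
    by (auto dest!: lt3 simp: nth_Cons split: nat.splits)
  ultimately show ?thesis by simp
qed

lemma input_noise_indep:
  assumes "B \<in> sets borel" "C \<in> sets borel"
  shows "prob ((u (Suc t) -` B \<inter> space M) \<inter> (w (Suc t) -` C \<inter> space M))
    = prob (u (Suc t) -` B \<inter> space M) * prob (w (Suc t) -` C \<inter> space M)"
proof -
  let ?S = "\<lambda>k. if k = (0::nat, Suc t) then u (Suc t) -` B \<inter> space M else w (Suc t) -` C \<inter> space M"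
  have "prob (\<Inter>k\<in>{(0, Suc t), (1, Suc t)}. ?S k) = (\<Prod>k\<in>{(0, Suc t), (1, Suc t)}. prob (?S k))"
    by (rule indep_setsD[OF source_indep])
      (use assms in \<open>auto simp: source_def sets_vimage_algebra_borel\<close>)
  then show ?thesis by (simp add: Int_commute)
qed

text \<open>The sources used up to time \<open>t\<close> and the two new ones at
  \<open>Suc t\<close> are disjoint subfamilies of an independent family, so the sigma-algebras they
  generate are independent. It remains to place F_t inside the first one.\<close>

lemma future_indep:
  assumes B: "B \<in> sets (\<F> t)" and C: "C \<in> sets (borel \<Otimes>\<^sub>M borel)"
  defines "V \<equiv> (\<lambda>\<omega>. (u (Suc t) \<omega>, w (Suc t) \<omega>))"
  shows "prob (B \<inter> (V -` C \<inter> space M)) = prob B * prob (V -` C \<inter> space M)"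
proof -
  define past where "past = {0::nat} \<times> {0..t} \<union> {1} \<times> {1..t} \<union> {(2, 0)}"
  define future where "future = {(0::nat, Suc t), (1, Suc t)}"
  \<comment> \<open>\<open>True\<close> indexes the past and \<open>False\<close> the future, to fit
    the indexed families of \<open>indep_sets_collect_sigma\<close>.\<close>
  define G where "G b = sigma_sets (space M) (\<Union>k\<in>(if b then past else future). source k)" for b
  define N where "N b = sigma (space M) (\<Union>k\<in>(if b then past else future). source k)" for b
  have stable: "Int_stable (source k)" if "k \<in> past \<union> future" for k
    using that by (auto simp: source_def past_def future_def intro: sets.Int_stable)
  have Pow: "source k \<subseteq> Pow (space M)" if "k \<in> past \<union> future" for k
    using that sets.sets_into_space
    by (fastforce simp: source_def past_def future_def)
  have spN: "space (N b) = space M" and setsN: "sets (N b) = G b" for b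
    unfolding N_def G_def using Pow
    by (auto intro!: space_measure_of sets_measure_of split: if_splits)
  have "indep_sets G UNIV"
    unfolding G_def
  proof (rule indep_sets_collect_sigma)
    show "indep_sets source (\<Union>b. if b then past else future)"
      by (rule indep_sets_mono_index[OF _ source_indep]) (auto simp: past_def future_def split: if_splits)
    show "disjoint_family (\<lambda>b. if b then past else future)"
      by (auto simp: disjoint_family_on_def past_def future_def)
  qed (use stable in \<open>auto split: if_splits\<close>)
  then have indep: "prob (D True \<inter> D False) = prob (D True) * prob (D False)"
    if "\<And>b. D b \<in> G b" for D
    using indep_setsD[of G UNIV UNIV D] that by (simp add: UNIV_bool Int_commute mult.commute)
  have src: "source k \<subseteq> sets (N b)" if "k \<in> (if b then past else future)" for k b
    unfolding setsN G_def using that by (blast intro: sigma_sets.Basic)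
  have umeas: "u s \<in> borel_measurable (N b)" if "(0, s) \<in> (if b then past else future)" for s b
    by (rule measurable_if_sets_vimage_subset) (use src[OF that] in \<open>simp add: spN source_def\<close>)
  have wmeas: "w s \<in> borel_measurable (N b)" if "(1, s) \<in> (if b then past else future)" for s b
    by (rule measurable_if_sets_vimage_subset) (use src[OF that] in \<open>simp add: spN source_def\<close>)
  have xmeas: "x 0 \<in> borel_measurable (N True)"
    by (rule measurable_if_sets_vimage_subset)
      (use src[of "(2, 0)" True] in \<open>simp add: spN source_def past_def\<close>)
  \<comment> \<open>Here the recursion enters: the states up to time \<open>t\<close> are measurable
    with respect to the past sources.\<close>
  have "sets (\<F> t) \<subseteq> sets (N True)"
    by (rule sets_nat_filtration_subset)
      (auto intro!: x_measurable xmeas umeas wmeas simp: spN past_def)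
  then have "B \<in> G True" using B setsN by auto
  moreover have "V -` C \<inter> space M \<in> G False"
  proof -
    have [measurable]: "u (Suc t) \<in> borel_measurable (N False)" "w (Suc t) \<in> borel_measurable (N False)"
      by (auto intro!: umeas wmeas simp: future_def)
    have "V \<in> N False \<rightarrow>\<^sub>M borel \<Otimes>\<^sub>M borel"
      unfolding V_def by measurable
    then show ?thesis
      using measurable_sets[OF _ C] spN setsN by metis
  qed
  ultimately show ?thesis
    using indep[of "\<lambda>b. if b then B else V -` C \<inter> space M"] by simp
qed

lemma conditional_small_ball:
  assumes v: "norm v = 1"
  shows "AE \<omega> in M. 1/32 \<le> cond_probability M (\<F> t)
    {\<omega> \<in> space M. \<bar>v \<bullet> lift_state \<sigma>u (x (Suc t) \<omega>) (u (Suc t) \<omega>)\<bar> \<ge> \<sigma>w / 2} \<omega>"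
    (is "AE \<omega> in M. _ \<le> cond_probability M _ ?E \<omega>")
proof (rule cond_probability_ge)
  let ?T = "borel \<Otimes>\<^sub>M borel :: ((real^'m) \<times> (real^'n)) measure"
  define V where "V \<omega> = (u (Suc t) \<omega>, w (Suc t) \<omega>)" for \<omega>
  have sub: "subalgebra M (\<F> t)" using is_filtration by (simp add: is_filtration_def)
  then show "subalgebra M (\<F> t)" .
  have [measurable]: "u s \<in> borel_measurable M" "w (Suc s) \<in> borel_measurable M" for s
    using u_meas w_meas by auto
  have V_meas: "V \<in> M \<rightarrow>\<^sub>M ?T" unfolding V_def by measurable
  have E_eq: "?E = {\<omega> \<in> space M. \<bar>lift_coeff \<sigma>u v (u (Suc t) \<omega>) \<bullet> (drift t \<omega> + w (Suc t) \<omega>)\<bar> \<ge> \<sigma>w / 2}"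
    by (auto simp: inner_lift_state system drift_def)
  have drift_F: "drift t \<in> borel_measurable (\<F> t)"
    by (intro drift_measurable measurable_nat_filtration) simp_all
  have [measurable]: "drift t \<in> borel_measurable M"
    using drift_F sub by (rule measurable_from_subalg[rotated])
  show "?E \<in> events" unfolding E_eq by measurable
  fix B assume B: "B \<in> sets (\<F> t)"
  \<comment> \<open>The sample point and the fresh pair (u, w) are decoupled:
    \<open>\<omega>\<close> determines only membership in \<open>B\<close> and the drift.
    Substituting the actual pair for \<open>y\<close> gives back
    \<open>B \<inter> ?E\<close>.\<close>
  define Q where "Q = {(\<omega>, y) \<in> space (\<F> t \<Otimes>\<^sub>M ?T). \<omega> \<in> B \<and>
    \<bar>lift_coeff \<sigma>u v (fst y) \<bullet> (drift t \<omega> + snd y)\<bar> \<ge> \<sigma>w / 2}"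
  have Q: "Q \<in> sets (\<F> t \<Otimes>\<^sub>M ?T)"
  proof -
    note [measurable] = drift_F B
    have "Q = {y \<in> space (\<F> t \<Otimes>\<^sub>M ?T). fst y \<in> B \<and>
        \<bar>lift_coeff \<sigma>u v (fst (snd y)) \<bullet> (drift t (fst y) + snd (snd y))\<bar> \<ge> \<sigma>w / 2}"
      by (auto simp: Q_def)
    also have "\<dots> \<in> sets (\<F> t \<Otimes>\<^sub>M ?T)" by measurable
    finally show ?thesis .
  qed
  have BM: "B \<in> events" using B sub by (auto simp: subalgebra_def)
  \<comment> \<open>The identity into the coarser space is a random variable generating F_t. Using
    it in \<open>independent_prob_ge\<close> freezes the drift at a point \<open>\<omega>0\<close>
    while input and noise stay random.\<close>
  have id_meas: "(\<lambda>\<omega>. \<omega>) \<in> M \<rightarrow>\<^sub>M \<F> t"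
    using sub by (auto intro!: measurableI simp: subalgebra_def dest: sets.sets_into_space)
  have "1/32 * prob B = expectation (\<lambda>\<omega>. 1/32 * indicat_real B \<omega>)"
    using BM by simp
  also have "\<dots> \<le> prob {\<omega> \<in> space M. (\<omega>, V \<omega>) \<in> Q}"
  proof (rule independent_prob_ge[OF id_meas V_meas _ Q])
    show "prob ((\<lambda>\<omega>. \<omega>) -` C \<inter> space M \<inter> (V -` D \<inter> space M))
        = prob ((\<lambda>\<omega>. \<omega>) -` C \<inter> space M) * prob (V -` D \<inter> space M)"
      if C: "C \<in> sets (\<F> t)" and D: "D \<in> sets ?T" for C D
    proof -
      have "(\<lambda>\<omega>. \<omega>) -` C \<inter> space M = C"
        using sets.sets_into_space[OF C] by (auto simp: space_nat_filtration)
      then show ?thesis using future_indep[OF C D] by (simp add: V_def[abs_def])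
    qed
    show "integrable M (\<lambda>\<omega>. 1/32 * indicat_real B \<omega>)"
      using BM by (simp add: integrable_real_indicator emeasure_eq_measure)
    fix \<omega>0 assume \<omega>0: "\<omega>0 \<in> space (\<F> t)"
    show "1/32 * indicat_real B \<omega>0 \<le> prob {\<omega> \<in> space M. (\<omega>0, V \<omega>) \<in> Q}"
    proof (cases "\<omega>0 \<in> B")
      case True
      have "{\<omega> \<in> space M. (\<omega>0, V \<omega>) \<in> Q}
          = {\<omega> \<in> space M. \<bar>lift_coeff \<sigma>u v (u (Suc t) \<omega>) \<bullet> (drift t \<omega>0 + w (Suc t) \<omega>)\<bar> \<ge> \<sigma>w / 2}"
        using True \<omega>0 by (auto simp: Q_def V_def space_pair_measure)
      moreover have "1/32 \<le> prob \<dots>"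
      proof (rule lift_coeff_small_ball[OF _ \<sigma>u_pos _ \<sigma>w_pos _ v])
        show "gaussian M (u (Suc t)) 0 (\<sigma>u\<^sup>2 *\<^sub>R mat 1)" by (rule u_gaussian)
        show "gaussian M (w (Suc t)) 0 (\<sigma>w\<^sup>2 *\<^sub>R mat 1)" by (rule w_gaussian) simp
      qed (rule input_noise_indep)
      ultimately show ?thesis using True by simp
    qed simp
  qed
  also have "{\<omega> \<in> space M. (\<omega>, V \<omega>) \<in> Q} = B \<inter> ?E"
    unfolding E_eq using sets.sets_into_space[OF BM]
    by (auto simp: Q_def V_def space_pair_measure space_nat_filtration)
  finally show "1/32 * prob B \<le> prob (B \<inter> ?E)" .
qed

end

section \<open>Verification of the block martingale small-ball condition\<close>

lemma lift_state_measurable: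
  assumes [measurable]: "X \<in> borel_measurable N" "U \<in> borel_measurable N"
  shows "(\<lambda>\<omega>. lift_state \<sigma> (X \<omega>) (U \<omega>)) \<in> borel_measurable N"
proof -
  have "(\<lambda>\<omega>. lift_state \<sigma> (X \<omega>) (U \<omega>) $ i) \<in> borel_measurable N" for i
    by (cases i; cases "fst i") (auto simp: lift_state_def)
  then show ?thesis
    by (subst borel_measurable_euclidean_space) (auto simp: Basis_vec_real inner_axis)
qed

lemma inner_scaled_identity:
  fixes v :: "real^'d"
  shows "v \<bullet> ((s *\<^sub>R mat 1) *v v) = s * (norm v)\<^sup>2"
  by (simp add: scaleR_matrix_vector_assoc[symmetric] power2_norm_eq_inner)

lemma pos_def_scaled_identity: "s > 0 \<Longrightarrow> pos_def (s *\<^sub>R mat 1 :: real^'d^'d)"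
  by (simp add: pos_def_def inner_scaled_identity transpose_scalar)

theorem theorem1:
  fixes M :: "'a measure"
    and A0 :: "real^'n^'n" and A :: "'m::finite \<Rightarrow> real^'n^'n"
    and \<sigma>u \<sigma>w :: real
    and x :: "nat \<Rightarrow> 'a \<Rightarrow> real^'n"
    and u :: "nat \<Rightarrow> 'a \<Rightarrow> real^'m"
    and w :: "nat \<Rightarrow> 'a \<Rightarrow> real^'n"
  assumes "prob_space M"
    and "\<sigma>u > 0" and "\<sigma>w > 0"
    and x0_meas: "x 0 \<in> borel_measurable M"
    and system: "\<And>t \<omega>. \<omega> \<in> space M \<Longrightarrow>
      x (Suc t) \<omega> = A0 *v x t \<omega> + (\<Sum>k\<in>UNIV. (u t \<omega> $ k) *\<^sub>R (A k *v x t \<omega>)) + w (Suc t) \<omega>"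
    and u_gaussian: "\<And>t. gaussian M (u t) 0 (\<sigma>u\<^sup>2 *\<^sub>R mat 1)"
    and u_indep: "prob_space.indep_vars M (\<lambda>_. borel) u UNIV"
    and w_gaussian: "\<And>t. t \<ge> 1 \<Longrightarrow> gaussian M (w t) 0 (\<sigma>w\<^sup>2 *\<^sub>R mat 1)"
    and w_indep: "prob_space.indep_vars M (\<lambda>_. borel) w {1..}"
    and mutual_indep: "prob_space.indep_sets M
      (\<lambda>i. [gen_events M UNIV u, gen_events M {1..} w, gen_events M {0} x] ! i) {..<3::nat}"
  shows "vec_bmsb M (nat_filtration M x u w) (\<lambda>t \<omega>. lift_state \<sigma>u (x t \<omega>) (u t \<omega>))
    1 (((1/2)\<^sup>2 * \<sigma>w\<^sup>2) *\<^sub>R mat 1) (9/320)"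
proof -
  interpret prob_space M by fact
  interpret bilinear_system M A0 A \<sigma>u \<sigma>w x u w
    by unfold_locales fact+
  let ?\<Gamma> = "((1/2)\<^sup>2 * \<sigma>w\<^sup>2) *\<^sub>R mat 1 :: real^('m option \<times> 'n)^('m option \<times> 'n)"
  let ?z = "\<lambda>t \<omega>. lift_state \<sigma>u (x t \<omega>) (u t \<omega>)"
  have z_meas: "?z t \<in> borel_measurable (\<F> t)" for t
    by (intro lift_state_measurable measurable_nat_filtration order_refl)
  have "bmsb M \<F> (\<lambda>t \<omega>. v \<bullet> ?z t \<omega>) 1 (sqrt (v \<bullet> (?\<Gamma> *v v))) (9/320)"
    if "v \<in> sphere 0 1" for v
  proof -
    have v: "norm v = 1" using that by simp
    have \<nu>: "sqrt (v \<bullet> (?\<Gamma> *v v)) = \<sigma>w / 2"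
      using \<sigma>w_pos v by (simp add: inner_scaled_identity real_sqrt_mult real_sqrt_divide)
    \<comment> \<open>With \<open>k = 1\<close> the block average has the single term at time
      \<open>j + 1\<close>, so a one-step bound for every \<open>t\<close> is the whole
      condition.\<close>
    have "AE \<omega> in M. 9/320 \<le> cond_probability M (\<F> t)
        {\<omega> \<in> space M. \<bar>v \<bullet> ?z (Suc t) \<omega>\<bar> \<ge> \<sigma>w / 2} \<omega>" for t
      using conditional_small_ball[OF v, of t] by eventually_elim simp
    moreover have "(\<lambda>\<omega>. v \<bullet> ?z t \<omega>) \<in> borel_measurable (\<F> t)" for t
      using z_meas by measurable
    ultimately show ?thesis
      unfolding bmsb_def \<nu> using is_filtration by simp
  qed
  then show ?thesis
    unfolding vec_bmsb_def
    using is_filtration z_meas pos_def_scaled_identity[of "(1/2)\<^sup>2 * \<sigma>w\<^sup>2"] \<sigma>w_pos by simp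
qed

end
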